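(* Let $D>0$ and $A\ge 2D$ be reals. Let $n$ be a positive integer with standard binary expansion $N_{\mathcal B}=n_\lambda\dots n_0$, $n_\lambda=1$, and let $N^*=n^*_{\lambda+1}\dots n^*_0$ be the output of Algorithm 2 on $N_{\mathcal B}$. Then $N^*$ is a canonical representation of $n$, and $T(N^*,\lambda+1)\le T(M,\lambda+1)$ for every canonical representation $M=m_{\lambda+1}\dots m_0$ of $n$.
   Context: A canonical representation of $n$ is a string $m_\mu\dots m_0$ with $m_i\in\{-1,0,1\}$ and $\sum_i m_i2^i=n$; $\bar1$ denotes $-1$. Strings are written most significant digit first. In patterns, $x^k$ is $k$ repetitions, $x^*$ is zero or more repetitions, and "ends with a pattern" means a suffix matches it. Time model: for a digit string $N=n_\lambda\dots n_0$, define recursively for $0\le i\le\lambda$: $T(N,i)=0$ if $i=0$ and $n_0=0$; $T(N,i)=T(N,i-1)$ if $i>0$ and $n_i=0$; $T(N,i)=iD+(|n_i|-1)A$ if $n_i\ne0$ and $n_j=0$ for all $0\le j<i$; and $T(N,i)=\max(T(N,i-1),iD)+|n_i|A$ otherwise. toNAF$(N,i)$: input a digit string $N=n_\lambda\dots n_0$ and a starting index $i$. Set $n'_j\leftarrow n_j$ for $j\le\lambda$, $n'_{\lambda+1}\leftarrow0$. While $i<\lambda$: if $n'_i=1$ and $n'_{i+1}=1$, set $n'_i\leftarrow-1$, $i\leftarrow i+1$; while $n'_i=1$ set $n'_i\leftarrow0$, $i\leftarrow i+1$; then set $n'_i\leftarrow1$ (continue the outer loop without incrementing $i$). Otherwise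 $i\leftarrow i+1$. Return $n'_{\lambda+1}\dots n'_0$. Algorithm 2: input $N_{\mathcal B}=n_\lambda\dots n_0$. Let $\ell$ be the index of the least significant $1$. The pattern tests are applied to the string $00n_\lambda\dots n_0$. If it ends with $11(01)^*010^*$: set $n_\ell\leftarrow-1$, $n_{\ell+1}\leftarrow1$ and return toNAF$(N_{\mathcal B},\ell+1)$. Else if it ends with $0(01)^*0110^*$: return toNAF$(N_{\mathcal B},\ell+1)$. Else return toNAF$(N_{\mathcal B},\ell)$. *)

theory Defs
  imports Complex_Main "HOL-Library.While_Combinator"
begin

text \<open>A digit string \<open>n\<^sub>\<lambda> \<dots> n\<^sub>0\<close> is represented by the list \<open>[n\<^sub>0, \<dots>, n\<^sub>\<lambda>]\<close>, so that
  \<open>N ! i\<close> is the digit of weight \<open>2 ^ i\<close>. Only the patterns below are written most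
  significant digit first; they are matched against the reversed list.\<close>

definition value_of :: "int list \<Rightarrow> int" where
  "value_of N = (\<Sum>i<length N. N ! i * 2 ^ i)"

definition canonical_rep :: "nat \<Rightarrow> nat \<Rightarrow> int list \<Rightarrow> bool" where
  "canonical_rep n \<mu> M \<longleftrightarrow> length M = \<mu> + 1 \<and> set M \<subseteq> {-1, 0, 1} \<and> value_of M = int n"

definition binary_expansion :: "nat \<Rightarrow> nat \<Rightarrow> int list \<Rightarrow> bool" where
  "binary_expansion n lam N \<longleftrightarrow>
     length N = lam + 1 \<and> set N \<subseteq> {0, 1} \<and> N ! lam = 1 \<and> value_of N = int n"

fun T :: "real \<Rightarrow> real \<Rightarrow> int list \<Rightarrow> nat \<Rightarrow> real" where
  "T D A N i =
     (if i = 0 \<and> N ! 0 = 0 then 0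
      else if i > 0 \<and> N ! i = 0 then T D A N (i - 1)
      else if N ! i \<noteq> 0 \<and> (\<forall>j<i. N ! j = 0) then real i * D + (real_of_int \<bar>N ! i\<bar> - 1) * A
      else max (T D A N (i - 1)) (real i * D) + real_of_int \<bar>N ! i\<bar> * A)"

declare T.simps [simp del]

definition clear_ones :: "int list \<times> nat \<Rightarrow> int list \<times> nat" where
  "clear_ones = while (\<lambda>(N, i). N ! i = 1) (\<lambda>(N, i). (N[i := 0], i + 1))"

text \<open>Both loops terminate on every input with starting index \<open>i\<close>: the outer one stops at
  \<open>\<lambda>\<close>, and \<open>clear_ones\<close> stops at the latest at the digit \<open>0\<close> appended at index \<open>\<lambda> + 1\<close>.\<close>

definition toNAF :: "int list \<Rightarrow> nat \<Rightarrow> int list" where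
  "toNAF N i =
     fst (while (\<lambda>(N', i). i < length N - 1)
       (\<lambda>(N', i).
          if N' ! i = 1 \<and> N' ! (i + 1) = 1
          then let (N'', k) = clear_ones (N'[i := -1], i + 1) in (N''[k := 1], k)
          else (N', i + 1))
       (N @ [0], i))"

definition ends_with :: "'a list \<Rightarrow> 'a list set \<Rightarrow> bool" where
  "ends_with S P \<longleftrightarrow> (\<exists>u. \<exists>v\<in>P. S = u @ v)"

text \<open>The patterns \<open>11(01)\<^sup>*010\<^sup>*\<close> and \<open>0(01)\<^sup>*0110\<^sup>*\<close>.\<close>

definition pattern1 :: "int list set" where
  "pattern1 = {[1, 1] @ concat (replicate j [0, 1]) @ [0, 1] @ replicate k 0 | j k. True}"

definition pattern2 :: "int list set" where
  "pattern2 = {[0] @ concat (replicate j [0, 1]) @ [0, 1, 1] @ replicate k 0 | j k. True}"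

definition algorithm2 :: "int list \<Rightarrow> int list" where
  "algorithm2 N =
     (let l = (LEAST i. i < length N \<and> N ! i = 1); S = [0, 0] @ rev N in
      if ends_with S pattern1 then toNAF (N[l := -1, l + 1 := 1]) (l + 1)
      else if ends_with S pattern2 then toNAF N (l + 1)
      else toNAF N l)"

end

theory Submission imports Defs begin

text \<open>All representations of \<open>n\<close> share the position \<open>v\<close> of their lowest nonzero digit, and unfolding the
  recursion shows that \<open>T\<close> is the maximum of \<open>i * D + A * w\<^sub>i\<close> over the nonzero digits at positions
  \<open>i > v\<close>, where \<open>w\<^sub>i\<close> counts the nonzero digits at positions \<open>\<ge> i\<close>. Since \<open>A \<ge> 2 * D\<close>, a term is
  dominated by that of a nonzero digit at most two positions below. If \<open>i\<close> has no such digit below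
  it, then two representations whose upper parts differ in value do so by one; this changes the
  minimal weight by at most one, and the competitor pays for it with nonzero digits at \<open>i - 1\<close> and
  \<open>i - 2\<close>. There remains the second lowest nonzero digit when it is at \<open>v + 1\<close> or \<open>v + 2\<close>: there
  one needs minimal total weight, and a nonzero digit at \<open>v + 1\<close> whenever minimal weight allows it.
  Writing \<open>w\<close> for the minimal weight, \<open>w (2 * y + 1) = 1 + min (w y) (w (y + 1))\<close>, and the two patterns
  describe when this minimum permits nonzero digits at both \<open>v\<close> and \<open>v + 1\<close>.\<close>

section \<open>Weight of the non-adjacent form\<close>

text \<open>The number of nonzero digits of the non-adjacent form. For odd \<open>n\<close> the
  residue modulo 4 selects the lowest digit 1 or -1 that makes the next digit 0, so the recursion
  continues with \<open>(n - 1) div 4\<close> or \<open>(n + 1) div 4\<close>.\<close>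

function naf_weight :: "int \<Rightarrow> int" where
  "naf_weight n =
     (if n = 0 then 0
      else if even n then naf_weight (n div 2)
      else if n mod 4 = 1 then 1 + naf_weight (n div 4)
      else 1 + naf_weight (n div 4 + 1))"
  by pat_completeness auto
termination
proof (relation "measure (\<lambda>n. nat \<bar>n\<bar>)")
  show "wf (measure (\<lambda>n::int. nat \<bar>n\<bar>))" by simp
qed (simp; presburger)+

declare naf_weight.simps [simp del]

lemma naf_weight_0 [simp]: "naf_weight 0 = 0"
  by (simp add: naf_weight.simps)

lemma naf_weight_double [simp]: "naf_weight (2 * y) = naf_weight y"
  by (subst naf_weight.simps) auto

lemma naf_weight_4k1: "naf_weight (4 * y + 1) = 1 + naf_weight y"
proof -
  have "4 * y + 1 \<noteq> 0" "odd (4 * y + 1)" "(4 * y + 1) mod 4 = 1" "(4 * y + 1) div 4 = y"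
    by presburger+
  then show ?thesis
    by (subst naf_weight.simps) simp
qed

lemma naf_weight_4k3: "naf_weight (4 * y + 3) = 1 + naf_weight (y + 1)"
proof -
  have "4 * y + 3 \<noteq> 0" "odd (4 * y + 3)" "(4 * y + 3) mod 4 \<noteq> 1" "(4 * y + 3) div 4 = y"
    by presburger+
  then show ?thesis
    by (subst naf_weight.simps) simp
qed

lemma naf_weight_4k: "naf_weight (4 * y) = naf_weight y"
  using naf_weight_double[of "2 * y"] by simp

lemma naf_weight_4k2: "naf_weight (4 * y + 2) = naf_weight (2 * y + 1)"
  using naf_weight_double[of "2 * y + 1"] by (simp add: algebra_simps)

lemma int_mod4_cases:
  fixes n :: int
  obtains r where "n = 4 * r" | r where "n = 4 * r + 1" | r where "n = 4 * r + 2" | r where "n = 4 * r + 3"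
proof -
  have "n = 4 * (n div 4) \<or> n = 4 * (n div 4) + 1 \<or> n = 4 * (n div 4) + 2 \<or> n = 4 * (n div 4) + 3"
    by presburger
  then show ?thesis using that by blast
qed

text \<open>An odd number may end in 1 or -1, leaving \<open>y\<close> or \<open>y + 1\<close>. The
  recursion always leaves the even one, and this is never worse: if that number is divisible by 4,
  both weights can be read off; otherwise it is \<open>2 * (2 * r + 1)\<close>, and the induction
  hypothesis at \<open>r\<close> applies.\<close>

lemma naf_weight_odd:
  "naf_weight (2 * y + 1) = 1 + min (naf_weight y) (naf_weight (y + 1))"
proof (induction "nat \<bar>y\<bar>" arbitrary: y rule: less_induct)
  case less
  show ?case
  proof (cases y rule: int_mod4_cases)
    case (1 r)
    then show ?thesis
      using naf_weight_4k1[of "2 * r"] naf_weight_4k1[of r] naf_weight_4k[of r] naf_weight_double[of r]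
      by (simp add: algebra_simps)
  next
    case (2 r)
    then have IH: "naf_weight (2 * r + 1) = 1 + min (naf_weight r) (naf_weight (r + 1))"
      by (intro less) (simp only: nat_less_eq_zless abs_ge_zero; arith)
    have "2 * y + 1 = 4 * (2 * r) + 3" "y + 1 = 4 * r + 2" using 2 by simp_all
    then show ?thesis
      using IH 2 naf_weight_4k3[of "2 * r"] naf_weight_4k1[of r] naf_weight_4k2[of r] by (simp add: algebra_simps)
  next
    case (3 r)
    then have IH: "naf_weight (2 * r + 1) = 1 + min (naf_weight r) (naf_weight (r + 1))"
      by (intro less) (simp only: nat_less_eq_zless abs_ge_zero; arith)
    have "2 * y + 1 = 4 * (2 * r + 1) + 1" "y + 1 = 4 * r + 3" using 3 by simp_all
    then show ?thesis
      using IH 3 naf_weight_4k1[of "2 * r + 1"] naf_weight_4k3[of r] naf_weight_4k2[of r] by (simp add: algebra_simps)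
  next
    case (4 r)
    have "2 * y + 1 = 4 * (2 * r + 1) + 3" "y + 1 = 4 * (r + 1)" "2 * r + 1 + 1 = 2 * (r + 1)"
      using 4 by simp_all
    then show ?thesis
      using 4 naf_weight_4k3[of "2 * r + 1"] naf_weight_4k3[of r] naf_weight_4k[of "r + 1"]
        naf_weight_double[of "r + 1"] by (simp only:)
  qed
qed

text \<open>Next to a multiple of 4 the difference is exactly one. Next to \<open>4 * r + 2\<close>,
  expanding \<open>naf_weight (2 * r + 1)\<close> as a minimum reduces the claim to \<open>r\<close>
  and \<open>r + 1\<close>.\<close>

lemma naf_weight_lipschitz: "\<bar>naf_weight (y + 1) - naf_weight y\<bar> \<le> 1"
proof (induction "nat \<bar>y\<bar>" arbitrary: y rule: less_induct)
  case less
  show ?case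
  proof (cases y rule: int_mod4_cases)
    case (1 r)
    then show ?thesis
      using naf_weight_4k1[of r] naf_weight_4k[of r] by (simp add: algebra_simps)
  next
    case (2 r)
    then have IH: "\<bar>naf_weight (r + 1) - naf_weight r\<bar> \<le> 1"
      by (intro less) (simp only: nat_less_eq_zless abs_ge_zero; arith)
    have "y + 1 = 4 * r + 2" using 2 by simp
    then show ?thesis
      using IH 2 naf_weight_4k1[of r] naf_weight_4k2[of r] naf_weight_odd[of r] by (simp add: algebra_simps)
  next
    case (3 r)
    then have IH: "\<bar>naf_weight (r + 1) - naf_weight r\<bar> \<le> 1"
      by (intro less) (simp only: nat_less_eq_zless abs_ge_zero; arith)
    have "y + 1 = 4 * r + 3" using 3 by simp
    then show ?thesis
      using IH 3 naf_weight_4k3[of r] naf_weight_4k2[of r] naf_weight_odd[of r] by (simp add: algebra_simps)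
  next
    case (4 r)
    have "y + 1 = 4 * (r + 1)" using 4 by simp
    then show ?thesis
      using 4 naf_weight_4k3[of r] naf_weight_4k[of "r + 1"] by (simp only:)
  qed
qed

section \<open>Digit strings\<close>

lemma value_of_Nil [simp]: "value_of [] = 0"
  by (simp add: value_of_def)

lemma value_of_Cons [simp]: "value_of (d # xs) = d + 2 * value_of xs"
  unfolding value_of_def length_Cons sum.lessThan_Suc_shift
  by (simp add: sum_distrib_left algebra_simps)

lemma value_of_append: "value_of (xs @ ys) = value_of xs + 2 ^ length xs * value_of ys"
  by (induction xs) (simp_all add: algebra_simps)

lemma value_of_split:
  assumes "i \<le> length xs"
  shows "value_of xs = value_of (take i xs) + 2 ^ i * value_of (drop i xs)"
  using value_of_append[of "take i xs" "drop i xs"] assms by simp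

lemma value_of_update:
  assumes "i < length xs"
  shows "value_of (xs[i := x]) = value_of xs + (x - xs ! i) * 2 ^ i"
  using assms
proof (induction xs arbitrary: i)
  case (Cons a xs)
  show ?case
  proof (cases i)
    case (Suc k)
    with Cons have "value_of (xs[k := x]) = value_of xs + (x - xs ! k) * 2 ^ k" by simp
    with Suc show ?thesis by (simp add: algebra_simps)
  qed simp
qed simp

lemma value_of_replicate_0 [simp]: "value_of (replicate k 0) = 0"
  by (induction k) simp_all

section \<open>Strings over the digits -1, 0, 1\<close>

abbreviation ternary :: "int list \<Rightarrow> bool" where
  "ternary xs \<equiv> set xs \<subseteq> {-1, 0, 1}"

lemma ternary_take: "ternary xs \<Longrightarrow> ternary (take i xs)"
  by (meson set_take_subset subset_trans)

lemma ternary_drop: "ternary xs \<Longrightarrow> ternary (drop i xs)"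
  by (meson set_drop_subset subset_trans)

lemma ternary_nth:
  assumes "ternary xs" "i < length xs"
  shows "xs ! i = -1 \<or> xs ! i = 0 \<or> xs ! i = 1"
  using assms nth_mem by blast

lemma abs_value_of_less: "ternary xs \<Longrightarrow> \<bar>value_of xs\<bar> < 2 ^ length xs"
  by (induction xs) auto

text \<open>The only even digit is 0, so parity settles the lowest digit; halving the value then
  settles the next one.\<close>

lemma low_digits_zero:
  assumes "ternary xs" "2 ^ v dvd value_of xs" "j < v" "j < length xs"
  shows "xs ! j = 0"
  using assms
proof (induction xs arbitrary: v j)
  case (Cons d ys)
  then obtain v' where v: "v = Suc v'" by (cases v) auto
  have "even (d + 2 * value_of ys)"
    using Cons.prems(2) v by (metis dvd_mult_left power_Suc value_of_Cons)
  with Cons.prems(1) have d: "d = 0" by auto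
  with Cons.prems(2) v have "2 ^ v' dvd value_of ys" by simp
  with Cons d v show ?case by (cases j) auto
qed simp

section \<open>Minimality of the weight of non-adjacent strings\<close>

definition weight :: "int list \<Rightarrow> int" where
  "weight xs = (\<Sum>x\<leftarrow>xs. \<bar>x\<bar>)"

lemma weight_simps [simp]:
  "weight [] = 0" "weight (x # xs) = \<bar>x\<bar> + weight xs" "weight (xs @ ys) = weight xs + weight ys"
  by (simp_all add: weight_def)

lemma weight_nonneg: "0 \<le> weight xs"
  by (induction xs) auto

text \<open>Prepending a digit \<open>d\<close> turns the value \<open>2 * x\<close> into a number
  at distance \<open>\<bar>d\<bar>\<close>, at most one, so the Lipschitz bound pays for it.\<close>

lemma naf_weight_le_weight:
  assumes "ternary xs"
  shows "naf_weight (value_of xs) \<le> weight xs"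
  using assms
proof (induction xs)
  case (Cons d xs)
  have "naf_weight (d + 2 * value_of xs) \<le> \<bar>d\<bar> + naf_weight (2 * value_of xs)"
    using Cons.prems naf_weight_lipschitz[of "2 * value_of xs"]
      naf_weight_lipschitz[of "2 * value_of xs - 1"]
    by (auto simp: algebra_simps)
  with Cons show ?case by simp
qed simp

fun non_adjacent :: "int list \<Rightarrow> bool" where
  "non_adjacent (x # y # xs) \<longleftrightarrow> (x = 0 \<or> y = 0) \<and> non_adjacent (y # xs)"
| "non_adjacent _ \<longleftrightarrow> True"

lemma non_adjacent_conv_nth:
  "non_adjacent xs \<longleftrightarrow> (\<forall>j. Suc j < length xs \<longrightarrow> xs ! j = 0 \<or> xs ! Suc j = 0)"
  by (induction xs rule: non_adjacent.induct) (auto simp: all_conj_distrib nth_Cons split: nat.splits)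

lemma non_adjacent_drop: "non_adjacent xs \<Longrightarrow> non_adjacent (drop i xs)"
  by (auto simp: non_adjacent_conv_nth)

text \<open>A nonzero lowest digit is followed by 0, so the value is one away from a multiple of 4
  and one step of \<open>naf_weight\<close> strips both digits. Two digits disappear at once, hence
  the induction on the length.\<close>

lemma weight_non_adjacent:
  assumes "ternary xs" "non_adjacent xs"
  shows "weight xs = naf_weight (value_of xs)"
  using assms
proof (induction xs rule: length_induct)
  case (1 xs)
  show ?case
  proof (cases xs)
    case (Cons d ys)
    show ?thesis
    proof (cases "d = 0")
      case True
      have "weight ys = naf_weight (value_of ys)"
        using 1 Cons non_adjacent_drop[OF 1(3), of 1] by simp
      then show ?thesis using Cons True by simp
    next
      case False
      show ?thesis
      proof (cases ys)
        case Nil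
        with 1 Cons False show ?thesis
          using naf_weight_4k1[of 0] naf_weight_4k3[of "-1"] by auto
      next
        case (Cons e zs)
        have xs: "xs = d # 0 # zs" using False Cons \<open>xs = d # ys\<close> 1 by auto
        have "non_adjacent zs"
          using non_adjacent_drop[OF 1(3), of 2] xs by simp
        then have "weight zs = naf_weight (value_of zs)"
          using 1 xs by simp
        then show ?thesis
          using 1(2) xs False naf_weight_4k1[of "value_of zs"]
            naf_weight_4k3[of "value_of zs - 1"] by (auto simp: algebra_simps)
      qed
    qed
  qed simp
qed

section \<open>The time model\<close>

lemma T_first:
  assumes "M ! v \<noteq> 0" "\<bar>M ! v\<bar> = 1" "\<forall>j<v. M ! j = 0"
  shows "T D A M v = real v * D"
  using assms by (subst T.simps) simp

text \<open>A nonzero digit at \<open>v\<close> below \<open>Suc k\<close> rules out the clause of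
  \<open>T\<close> for the first nonzero digit.\<close>

lemma T_Suc:
  assumes "M ! v \<noteq> 0" "v \<le> k" "M ! Suc k \<in> {-1, 0, 1}"
  shows "T D A M (Suc k) =
    (if M ! Suc k = 0 then T D A M k else max (T D A M k) (real (Suc k) * D) + A)"
proof -
  have "\<not> (\<forall>j<Suc k. M ! j = 0)" using assms(1,2) le_imp_less_Suc by blast
  then show ?thesis using assms(3) by (subst T.simps) auto
qed

locale digit_string =
  fixes M :: "int list" and v :: nat
  assumes ternary: "ternary M"
    and first: "v < length M" "M ! v \<noteq> 0" "\<forall>j<v. M ! j = 0"
begin

lemma digit: "j < length M \<Longrightarrow> M ! j \<in> {-1, 0, 1}"
  using ternary_nth[OF ternary] by blast

lemma T_ge_first:
  fixes D A :: real
  assumes "D \<ge> 0" "A \<ge> 0" "v \<le> k" "k < length M"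
  shows "real v * D \<le> T D A M k"
  using assms(3,4)
proof (induction k rule: dec_induct)
  case base
  have "\<bar>M ! v\<bar> = 1" using digit[OF first(1)] first(2) by auto
  then show ?case using T_first first by simp
next
  case (step k)
  then show ?case using T_Suc[OF first(2) step(1) digit[OF step(4)], of D A] assms(2) by auto
qed

text \<open>Positive weight asks for a nonzero digit at or above \<open>i\<close>, not at
  \<open>i\<close> itself. This allows a term of one string to be compared with another string whose
  digit at \<open>i\<close> may be 0.\<close>

lemma T_lower:
  fixes D A :: real
  assumes "D \<ge> 0" "A \<ge> 0" "v \<le> k" "k < length M" "v < i"
    and "0 < weight (drop i (take (Suc k) M))"
  shows "real i * D + A * weight (drop i (take (Suc k) M)) \<le> T D A M k"
  using assms(3,4,6)
proof (induction k rule: dec_induct)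
  case base
  then show ?case using assms(5) by simp
next
  case (step k)
  let ?W = "weight (drop i (take (Suc k) M))"
  have tk: "take (Suc (Suc k)) M = take (Suc k) M @ [M ! Suc k]"
    using step.prems(1) by (simp add: take_Suc_conv_app_nth)
  have len: "length (take (Suc k) M) = Suc k" using step.prems(1) by simp
  have T: "T D A M (Suc k) =
    (if M ! Suc k = 0 then T D A M k else max (T D A M k) (real (Suc k) * D) + A)"
    using T_Suc[OF first(2) step(1) digit] step.prems by blast
  have i: "i \<le> Suc k"
    using step.prems(2) len by (cases "i \<le> Suc k") auto
  have W: "weight (drop i (take (Suc (Suc k)) M)) = ?W + \<bar>M ! Suc k\<bar>"
    unfolding tk using len i by simp
  show ?case
  proof (cases "M ! Suc k = 0")
    case True
    then show ?thesis using W T step by simp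
  next
    case False
    then have a: "\<bar>M ! Suc k\<bar> = 1" using digit[of "Suc k"] step.prems by auto
    show ?thesis
    proof (cases "?W > 0")
      case True
      then have "real i * D + A * ?W \<le> T D A M k" using step by simp
      then show ?thesis unfolding W a T using False by (simp add: algebra_simps)
    next
      case F: False
      then have "?W = 0" using weight_nonneg[of "drop i (take (Suc k) M)"] by simp
      moreover have "real i * D \<le> real (Suc k) * D"
        using i assms(1) by (intro mult_right_mono) auto
      ultimately show ?thesis unfolding W a T using False by simp
    qed
  qed
qed

text \<open>Converse of the lower bound: \<open>T\<close> is at most any \<open>X\<close> that
  bounds \<open>v * D\<close> and the terms at the nonzero positions above \<open>v\<close>.\<close>

lemma T_upper:
  fixes D A X :: real
  assumes "D \<ge> 0" "v \<le> k" "k < length M" "real v * D \<le> X"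
    and "\<And>i. v < i \<Longrightarrow> i \<le> k \<Longrightarrow> M ! i \<noteq> 0 \<Longrightarrow>
      real i * D + A * weight (drop i (take (Suc k) M)) \<le> X"
  shows "T D A M k \<le> X"
  using assms(2-)
proof (induction k arbitrary: X rule: dec_induct)
  case base
  have "\<bar>M ! v\<bar> = 1" using digit[OF first(1)] first(2) by auto
  then show ?case using T_first first base by simp
next
  case (step k)
  have tk: "take (Suc (Suc k)) M = take (Suc k) M @ [M ! Suc k]"
    using step.prems(1) by (simp add: take_Suc_conv_app_nth)
  have len: "length (take (Suc k) M) = Suc k" using step.prems(1) by simp
  have T: "T D A M (Suc k) =
    (if M ! Suc k = 0 then T D A M k else max (T D A M k) (real (Suc k) * D) + A)"
    using T_Suc[OF first(2) step(1) digit] step.prems by blast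
  have W: "weight (drop i (take (Suc (Suc k)) M)) =
    weight (drop i (take (Suc k) M)) + \<bar>M ! Suc k\<bar>" if "i \<le> Suc k" for i
    unfolding tk using len that by simp
  have terms: "real i * D + A * (weight (drop i (take (Suc k) M)) + \<bar>M ! Suc k\<bar>) \<le> X"
    if "v < i" "i \<le> Suc k" "M ! i \<noteq> 0" for i
    using step.prems(3)[OF that] W[OF that(2)] by simp
  show ?case
  proof (cases "M ! Suc k = 0")
    case True
    have "T D A M k \<le> X"
      using step.prems(1,2) terms True by (intro step.IH) auto
    then show ?thesis using True T by simp
  next
    case False
    then have a: "\<bar>M ! Suc k\<bar> = 1" using digit[of "Suc k"] step.prems by auto
    have top: "real (Suc k) * D + A \<le> X"
      using terms[of "Suc k"] False step(1) len a by simp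
    have "real v * D \<le> real (Suc k) * D"
      using step(1) assms(1) by (intro mult_right_mono) auto
    \<comment> \<open>A nonzero top digit adds \<open>A\<close> to every term, so the induction
      hypothesis is used with the bound \<open>X - A\<close>.\<close>
    then have "T D A M k \<le> X - A"
      using step.prems(1) terms a top
      by (intro step.IH) (auto simp: algebra_simps)
    then show ?thesis using False T top by simp
  qed
qed

end

section \<open>Conversion to non-adjacent form\<close>

lemma clear_ones_unfold:
  "clear_ones (N, i) = (if N ! i = 1 then clear_ones (N[i := 0], i + 1) else (N, i))"
  unfolding clear_ones_def by (subst while_unfold) simp

text \<open>The ones cleared at positions \<open>i\<close> to \<open>k - 1\<close> amount to
  \<open>2 ^ k - 2 ^ i\<close>. The final digit 0 stops the loop inside the list.\<close>

lemma clear_ones_spec: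
  assumes "i < length N" "N ! (length N - 1) = 0" "\<And>j. i \<le> j \<Longrightarrow> j < length N \<Longrightarrow> N ! j \<in> {0, 1}"
  shows "\<exists>N' k. clear_ones (N, i) = (N', k) \<and> i \<le> k \<and> k < length N \<and> length N' = length N \<and>
    N' ! k = 0 \<and> (\<forall>j. j < i \<or> k \<le> j \<longrightarrow> N' ! j = N ! j) \<and> (\<forall>j. i \<le> j \<and> j < k \<longrightarrow> N' ! j = 0) \<and>
    value_of N' + 2 ^ k = value_of N + 2 ^ i"
  using assms
proof (induction "length N - i" arbitrary: N i rule: less_induct)
  case less
  show ?case
  proof (cases "N ! i = 1")
    case False
    then have "clear_ones (N, i) = (N, i)" "N ! i = 0"
      using less(4)[of i] less(2) by (auto simp: clear_ones_unfold)
    then show ?thesis using less(2) by fastforce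
  next
    case True
    then have i: "Suc i < length N" using less(2,3)
      by (metis One_nat_def Suc_lessI diff_Suc_1 zero_neq_one)
    have "\<exists>N' k. clear_ones (N[i := 0], i + 1) = (N', k) \<and> i + 1 \<le> k \<and> k < length (N[i := 0]) \<and>
        length N' = length (N[i := 0]) \<and> N' ! k = 0 \<and>
        (\<forall>j. j < i + 1 \<or> k \<le> j \<longrightarrow> N' ! j = N[i := 0] ! j) \<and> (\<forall>j. i + 1 \<le> j \<and> j < k \<longrightarrow> N' ! j = 0) \<and>
        value_of N' + 2 ^ k = value_of (N[i := 0]) + 2 ^ (i + 1)"
      by (rule less(1)) (use i less(3,4) in auto)
    then obtain N' k where N': "clear_ones (N[i := 0], i + 1) = (N', k)" "i + 1 \<le> k" "k < length N"
        "length N' = length N" "N' ! k = 0"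
        "\<forall>j. j < i + 1 \<or> k \<le> j \<longrightarrow> N' ! j = N[i := 0] ! j"
        "\<forall>j. i + 1 \<le> j \<and> j < k \<longrightarrow> N' ! j = 0"
        "value_of N' + 2 ^ k = value_of (N[i := 0]) + 2 ^ (i + 1)"
      unfolding length_list_update by blast
    have "clear_ones (N, i) = (N', k)" using True N'(1) by (subst clear_ones_unfold) simp
    moreover have "N' ! j = N ! j" if "j < i \<or> k \<le> j" for j
      using N'(2) N'(6)[rule_format, of j] that by auto
    moreover have "N' ! j = 0" if "i \<le> j" "j < k" for j
      using N'(6,7)[rule_format, of j] that less(2) by (cases "j = i") auto
    moreover have "value_of N' + 2 ^ k = value_of N + 2 ^ i"
      using N'(8) value_of_update[OF less(2), of 0] True by simp
    ultimately show ?thesis using N'(2-5) by (intro exI[of _ N'] exI[of _ k]) auto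
  qed
qed

text \<open>Position \<open>length N\<close> holds the appended digit, which stays 0 until a carry
  reaches it. Digits from \<open>i\<close> on are still binary, and the last clause includes the
  pair at \<open>i - 1\<close> and \<open>i\<close>.\<close>

definition toNAF_inv :: "int list \<Rightarrow> nat \<Rightarrow> int list \<times> nat \<Rightarrow> bool" where
  "toNAF_inv N i0 = (\<lambda>(R, i). length R = Suc (length N) \<and> i0 \<le> i \<and> i \<le> length N \<and>
     (i < length N \<longrightarrow> R ! length N = 0) \<and> (\<forall>j<i0. R ! j = N ! j) \<and> value_of R = value_of N \<and>
     (\<forall>j. i0 \<le> j \<and> j \<le> length N \<longrightarrow> R ! j \<in> {-1, 0, 1}) \<and>
     (\<forall>j. i \<le> j \<and> j \<le> length N \<longrightarrow> R ! j \<in> {0, 1}) \<and>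
     (\<forall>j. i0 \<le> j \<and> j < i \<longrightarrow> R ! j = 0 \<or> R ! Suc j = 0))"

lemma toNAF_inv_skip:
  assumes inv: "toNAF_inv N i0 (R, i)" and i: "i < length N - 1" and "R ! i = 0 \<or> R ! Suc i = 0"
  shows "toNAF_inv N i0 (R, Suc i)"
proof -
  have "R ! j = 0 \<or> R ! Suc j = 0" if "i0 \<le> j" "j < Suc i" for j
    using inv that assms(3) unfolding toNAF_inv_def by (cases "j = i") auto
  moreover have "R ! j \<in> {0, 1}" if "Suc i \<le> j" "j \<le> length N" for j
    using inv that unfolding toNAF_inv_def by auto
  ultimately show ?thesis
    using inv i unfolding toNAF_inv_def split_conv by (intro conjI allI impI) (elim conjE; simp)+
qed

text \<open>A run of ones from \<open>i\<close> to \<open>k - 1\<close> is replaced by its equal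
  value \<open>2 ^ k - 2 ^ i\<close>. As the run has at least two ones, \<open>k\<close> is at least
  \<open>i + 2\<close>, and a zero separates the new digits -1 and 1.\<close>

lemma toNAF_inv_step:
  assumes inv: "toNAF_inv N i0 (R, i)" and i: "i < length N - 1"
    and ones: "R ! i = 1" "R ! (i + 1) = 1"
    and ck: "clear_ones (R[i := -1], i + 1) = (R', k)"
  shows "i < k \<and> toNAF_inv N i0 (R'[k := 1], k)"
proof -
  have len: "length R = Suc (length N)" and le: "i0 \<le> i" and top: "R ! length N = 0"
    and low: "\<And>j. j < i0 \<Longrightarrow> R ! j = N ! j" and val: "value_of R = value_of N"
    and tern: "\<And>j. i0 \<le> j \<Longrightarrow> j \<le> length N \<Longrightarrow> R ! j \<in> {-1, 0, 1}"
    and bin: "\<And>j. i \<le> j \<Longrightarrow> j \<le> length N \<Longrightarrow> R ! j \<in> {0, 1}"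
    and adj: "\<And>j. i0 \<le> j \<Longrightarrow> j < i \<Longrightarrow> R ! j = 0 \<or> R ! Suc j = 0"
    using inv i unfolding toNAF_inv_def by auto
  have "\<exists>N' k. clear_ones (R[i := -1], i + 1) = (N', k) \<and> i + 1 \<le> k \<and> k < length (R[i := -1]) \<and>
      length N' = length (R[i := -1]) \<and> N' ! k = 0 \<and>
      (\<forall>j. j < i + 1 \<or> k \<le> j \<longrightarrow> N' ! j = R[i := -1] ! j) \<and> (\<forall>j. i + 1 \<le> j \<and> j < k \<longrightarrow> N' ! j = 0) \<and>
      value_of N' + 2 ^ k = value_of (R[i := -1]) + 2 ^ (i + 1)"
    by (rule clear_ones_spec) (use i len top bin in auto)
  then have k: "i < k" "k \<le> length N" "length R' = Suc (length N)" "R' ! k = 0"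
      and high: "\<And>j. j < i + 1 \<or> k \<le> j \<Longrightarrow> R' ! j = R[i := -1] ! j"
      and zero: "\<And>j. i + 1 \<le> j \<Longrightarrow> j < k \<Longrightarrow> R' ! j = 0"
      and val': "value_of R' + 2 ^ k = value_of (R[i := -1]) + 2 ^ (i + 1)"
    using ck len by auto
  have "k \<noteq> i + 1" using high[of k] k ones i by auto
  then have k2: "i + 2 \<le> k" using k by simp
  let ?S = "R'[k := 1]"
  have S_high: "?S ! j = R ! j" if "k < j" for j
    using high[of j] that k by simp
  have S_k: "?S ! k = 1" using k by simp
  have S_zero: "?S ! j = 0" if "i < j" "j < k" for j using zero that by simp
  have S_i: "?S ! i = -1" using high[of i] k i len by simp
  have S_low: "?S ! j = R ! j" if "j < i" for j using high[of j] that k by simp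
  have "value_of ?S = value_of N"
    using val' val value_of_update[of k R' 1] k value_of_update[of i R "-1"] ones i len
    by (simp add: algebra_simps)
  moreover have "?S ! j \<in> {-1, 0, 1}" if "i0 \<le> j" "j \<le> length N" for j
    using tern[OF that] S_low[of j] S_i S_zero[of j] S_k S_high[of j]
    by (cases "j = i"; cases "j = k"; cases "j < i"; cases "j < k") auto
  moreover have "?S ! j \<in> {0, 1}" if "k \<le> j" "j \<le> length N" for j
    using bin[of j] that k S_high[of j] S_k by (cases "j = k") auto
  moreover have "?S ! j = 0 \<or> ?S ! Suc j = 0" if "i0 \<le> j" "j < k" for j
  proof -
    consider "Suc j < i" | "Suc j = i" | "j = i" | "i < j" by linarith
    then show ?thesis
    proof cases
      case 1
      then show ?thesis using adj[OF that(1)] S_low[of j] S_low[of "Suc j"] by simp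
    next
      case 2
      then show ?thesis using adj[OF that(1)] S_low[of j] ones by simp
    next
      case 3
      then show ?thesis using S_zero[of "Suc j"] k2 by simp
    next
      case 4
      then show ?thesis using S_zero[of j] that by simp
    qed
  qed
  moreover have "?S ! length N = 0" if "k < length N" using S_high[OF that] top by simp
  moreover have "?S ! j = N ! j" if "j < i0" for j using S_low[of j] low[OF that] that le by simp
  ultimately show ?thesis using k le unfolding toNAF_inv_def by auto
qed

text \<open>Only the digits from \<open>i0\<close> on are assumed binary, because Algorithm 2 may
  leave a -1 just below the starting index.\<close>

lemma toNAF_spec:
  assumes "i0 < length N" "\<And>j. i0 \<le> j \<Longrightarrow> j < length N \<Longrightarrow> N ! j \<in> {0, 1}"
  shows "length (toNAF N i0) = Suc (length N)" "\<And>j. j < i0 \<Longrightarrow> toNAF N i0 ! j = N ! j"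
    "value_of (toNAF N i0) = value_of N" "ternary (drop i0 (toNAF N i0))"
    "non_adjacent (drop i0 (toNAF N i0))"
proof -
  define b where "b = (\<lambda>(N' :: int list, i). i < length N - 1)"
  define c where "c = (\<lambda>(N', i).
          if N' ! i = 1 \<and> N' ! (i + 1) = 1
          then let (N'', k) = clear_ones (N'[i := -1], i + 1) in (N''[k := 1], k)
          else (N', i + 1))"
  have step: "toNAF_inv N i0 (c s) \<and> (c s, s) \<in> measure (\<lambda>(R, i). length N - i)"
    if inv: "toNAF_inv N i0 s" and b: "b s" for s
  proof -
    obtain R i where s: "s = (R, i)" by (cases s)
    have i: "i < length N - 1" using b s by (simp add: b_def)
    show ?thesis
    proof (cases "R ! i = 1 \<and> R ! (i + 1) = 1")
      case True
      obtain R' k where ck: "clear_ones (R[i := -1], i + 1) = (R', k)" by fastforce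
      then have "c s = (R'[k := 1], k)" using True s by (simp add: c_def)
      then show ?thesis using toNAF_inv_step[OF inv[unfolded s] i _ _ ck] True s i by auto
    next
      case False
      then have c: "c s = (R, i + 1)" using s by (auto simp: c_def)
      have "R ! i \<in> {0, 1}" "R ! (i + 1) \<in> {0, 1}"
        using inv i s unfolding toNAF_inv_def by auto
      then have "R ! i = 0 \<or> R ! Suc i = 0" using False by auto
      then have "toNAF_inv N i0 (R, i + 1)"
        using toNAF_inv_skip[OF inv[unfolded s] i] by simp
      then show ?thesis using c s i by simp
    qed
  qed
  have "toNAF_inv N i0 (N @ [0], i0)"
    using assms unfolding toNAF_inv_def by (auto simp: nth_append value_of_append le_less)
  then have "toNAF_inv N i0 (while b c (N @ [0], i0)) \<and> \<not> b (while b c (N @ [0], i0))"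
    by (rule while_rule[where P = "toNAF_inv N i0" and r = "measure (\<lambda>(R, i). length N - i)"])
      (use step in auto)
  moreover obtain R i where R: "while b c (N @ [0], i0) = (R, i)" by fastforce
  ultimately have inv: "toNAF_inv N i0 (R, i)" and i: "length N - 1 \<le> i"
    by (simp_all add: b_def)
  have toNAF: "toNAF N i0 = R"
    using R unfolding toNAF_def b_def c_def by simp
  have "R ! j = 0 \<or> R ! Suc j = 0" if "i0 \<le> j" "j < length N" for j
  proof (cases "j < i")
    case True
    then show ?thesis using inv that unfolding toNAF_inv_def by auto
  next
    \<comment> \<open>The loop ended at the last input digit without a carry beyond it, so the
      appended digit is still 0.\<close>
    case False
    then have "i < length N" "Suc j = length N" using that i by auto
    then show ?thesis using inv unfolding toNAF_inv_def by auto
  qed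
  moreover have len: "length R = Suc (length N)" using inv unfolding toNAF_inv_def by auto
  ultimately show "non_adjacent (drop i0 (toNAF N i0))"
    unfolding toNAF non_adjacent_conv_nth by auto
  have "R ! (i0 + j) \<in> {-1, 0, 1}" if "j < Suc (length N) - i0" for j
    using inv that unfolding toNAF_inv_def by auto
  then have "drop i0 R ! j \<in> {-1, 0, 1}" if "j < length (drop i0 R)" for j
    using that len by simp
  then show "ternary (drop i0 (toNAF N i0))"
    unfolding toNAF by (metis in_set_conv_nth subsetI)
  show "length (toNAF N i0) = Suc (length N)" "\<And>j. j < i0 \<Longrightarrow> toNAF N i0 ! j = N ! j"
    "value_of (toNAF N i0) = value_of N"
    using inv unfolding toNAF toNAF_inv_def by auto
qed

section \<open>Comparing two digit strings\<close>

lemma value_of_take_Suc: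
  "k < length xs \<Longrightarrow> value_of (take (Suc k) xs) = value_of (take k xs) + 2 ^ k * xs ! k"
  by (simp add: take_Suc_conv_app_nth value_of_append)

lemma weight_drop_Suc: "i < length xs \<Longrightarrow> weight (drop i xs) = \<bar>xs ! i\<bar> + weight (drop (Suc i) xs)"
  by (metis Cons_nth_drop_Suc weight_simps(2))

lemma weight_drop_mono: "i \<le> j \<Longrightarrow> weight (drop j xs) \<le> weight (drop i xs)"
proof (induction j rule: dec_induct)
  case (step k)
  then show ?case using weight_drop_Suc[of k xs] by (cases "k < length xs") auto
qed simp

lemma (in digit_string) value_of_first:
  "value_of M = 2 ^ v * (M ! v + 2 * value_of (drop (Suc v) M))"
proof -
  have "take v M = replicate v 0"
    using first by (intro nth_equalityI) auto
  then have "value_of M = 2 ^ v * value_of (drop v M)"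
    using value_of_split[of v M] first(1) by simp
  then show ?thesis
    using Cons_nth_drop_Suc[OF first(1)] value_of_Cons by metis
qed

text \<open>A zero at \<open>v\<close> would make the cofactor \<open>1 + 2 * y\<close> even. Thus
  the value alone determines the lowest nonzero position.\<close>

lemma digit_stringI:
  assumes "ternary M" "v < length M" "value_of M = 2 ^ v * (1 + 2 * y)"
  shows "digit_string M v"
proof
  show low: "\<forall>j<v. M ! j = 0" using low_digits_zero[OF assms(1), of v] assms(2,3) by simp
  show "M ! v \<noteq> 0"
  proof
    assume z: "M ! v = 0"
    have "take v M = replicate v 0" using low assms(2) by (intro nth_equalityI) auto
    then have "value_of M = 2 ^ v * value_of (drop v M)"
      using value_of_split[of v M] assms(2) by simp
    moreover have "value_of (drop v M) = 2 * value_of (drop (Suc v) M)"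
      using Cons_nth_drop_Suc[OF assms(2)] value_of_Cons z by (metis add_0)
    ultimately have "1 + 2 * y = 2 * value_of (drop (Suc v) M)" using assms(3) by simp
    then show False by presburger
  qed
qed (use assms in auto)

text \<open>With \<open>x\<close>, \<open>x'\<close> the values of the two upper parts and \<open>c\<close> the value of the two digits of \<open>M\<close> at
  \<open>m\<close> and \<open>m + 1\<close>, the number \<open>2 ^ m * (4 * (x - x') - c)\<close> is a difference of two numbers smaller
  than \<open>2 ^ m\<close> in absolute value. Hence \<open>x \<noteq> x'\<close> forces \<open>\<bar>c\<bar> = 3\<close>.\<close>

lemma gap_cases:
  assumes R: "ternary R" and M: "ternary M"
    and len: "Suc m < length R" "Suc m < length M" and val: "value_of R = value_of M"
    and gap: "R ! m = 0" "R ! Suc m = 0"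
  shows "value_of (drop (Suc (Suc m)) R) = value_of (drop (Suc (Suc m)) M) \<or>
    \<bar>value_of (drop (Suc (Suc m)) R) - value_of (drop (Suc (Suc m)) M)\<bar> = 1 \<and>
    M ! m \<noteq> 0 \<and> M ! Suc m \<noteq> 0"
proof -
  define x where "x = value_of (drop (Suc (Suc m)) R)"
  define x' where "x' = value_of (drop (Suc (Suc m)) M)"
  define c where "c = M ! m + 2 * M ! Suc m"
  define P :: int where "P = 2 ^ m"
  have P: "P > 0" by (simp add: P_def)
  have a: "\<bar>value_of (take m R)\<bar> < P" and b: "\<bar>value_of (take m M)\<bar> < P"
    using abs_value_of_less[OF ternary_take[OF R, of m]]
      abs_value_of_less[OF ternary_take[OF M, of m]] len by (simp_all add: P_def)
  have "value_of R = value_of (take m R) + 4 * P * x"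
    using value_of_split[of "Suc (Suc m)" R] len gap by (simp add: value_of_take_Suc x_def P_def)
  moreover have "value_of M = value_of (take m M) + P * c + 4 * P * x'"
    using value_of_split[of "Suc (Suc m)" M] len
    by (simp add: value_of_take_Suc x'_def P_def c_def algebra_simps)
  ultimately have "P * (4 * (x - x') - c) = value_of (take m M) - value_of (take m R)"
    using val by (simp add: algebra_simps)
  then have "\<bar>P * (4 * (x - x') - c)\<bar> < P * 2" using a b by linarith
  then have "\<bar>4 * (x - x') - c\<bar> < 2"
    using P by (simp only: abs_mult abs_of_pos mult_less_cancel_left_pos)
  moreover have "M ! m \<in> {-1, 0, 1}" "M ! Suc m \<in> {-1, 0, 1}"
    using ternary_nth[OF M] len by auto
  ultimately show ?thesis unfolding x_def[symmetric] x'_def[symmetric] c_def by auto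
qed

text \<open>\<open>R\<close> is the string to be proved optimal, \<open>M\<close> an arbitrary
  competitor. Above \<open>v\<close> each has value \<open>y\<close> or \<open>y + 1\<close>,
  according to its digit 1 or -1 at \<open>v\<close>. In \<open>second\<close>,
  \<open>2 * (y div 2) + 1\<close> is the odd one of these two: if \<open>R\<close> has a 0 at
  \<open>v + 1\<close>, every odd tail is strictly heavier. Non-adjacency starts at
  \<open>v + 1\<close>, as Algorithm 2 may make the digits at \<open>v\<close> and
  \<open>v + 1\<close> both nonzero.\<close>

locale same_value = R: digit_string R v + M: digit_string M v
  for R M :: "int list" and v :: nat +
  fixes L :: nat and y :: int
  assumes length: "length R = Suc L" "length M = Suc L"
    and vals: "value_of R = 2 ^ v * (1 + 2 * y)" "value_of M = 2 ^ v * (1 + 2 * y)"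
    and non_adjacent: "non_adjacent (drop (Suc v) R)"
    and minimal: "weight (drop (Suc v) R) \<le> min (naf_weight y) (naf_weight (y + 1))"
    and second: "R ! Suc v = 0 \<Longrightarrow> weight (drop (Suc v) R) < naf_weight (2 * (y div 2) + 1)"
begin

lemma value_of_tail: "value_of (drop (Suc v) M) \<in> {y, y + 1}"
proof -
  have "M ! v + 2 * value_of (drop (Suc v) M) = 1 + 2 * y"
    using M.value_of_first vals by simp
  then show ?thesis using M.digit[OF M.first(1)] by auto
qed

lemma weight_tail_le: "weight (drop (Suc v) R) \<le> weight (drop (Suc v) M)"
  using naf_weight_le_weight[OF ternary_drop[OF M.ternary, of "Suc v"]] value_of_tail minimal by auto

lemma weight_tail_less:
  assumes "Suc v < length M" "R ! Suc v = 0" "M ! Suc v \<noteq> 0"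
  shows "weight (drop (Suc v) R) < weight (drop (Suc v) M)"
proof -
  have "value_of (drop (Suc v) M) = M ! Suc v + 2 * value_of (drop (Suc (Suc v)) M)"
    using Cons_nth_drop_Suc[OF assms(1)] value_of_Cons by metis
  then have "odd (value_of (drop (Suc v) M))"
    using M.digit[OF assms(1)] assms(3) by auto
  with value_of_tail have "value_of (drop (Suc v) M) = 2 * (y div 2) + 1" by auto
  then show ?thesis
    using naf_weight_le_weight[OF ternary_drop[OF M.ternary, of "Suc v"]] second[OF assms(2)] by simp
qed

text \<open>The part of \<open>R\<close> above the gap has minimal weight for its value. If
  \<open>M\<close> has a different value there, minimal weights differ by at most one, while
  \<open>M\<close> has two further nonzero digits at \<open>m\<close> and
  \<open>m + 1\<close>.\<close>

lemma weight_gap: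
  assumes "v < m" "Suc m \<le> L" "R ! m = 0" "R ! Suc m = 0"
  shows "weight (drop (Suc (Suc m)) R) \<le> weight (drop (Suc (Suc m)) M) \<or>
    weight (drop (Suc (Suc m)) R) < weight (drop m M)"
proof -
  let ?x = "value_of (drop (Suc (Suc m)) R)" and ?x' = "value_of (drop (Suc (Suc m)) M)"
  have "drop (Suc (Suc m)) R = drop (Suc m - v) (drop (Suc v) R)"
    using assms(1) by simp
  then have R: "weight (drop (Suc (Suc m)) R) = naf_weight ?x"
    using weight_non_adjacent[OF ternary_drop[OF R.ternary]] non_adjacent_drop[OF non_adjacent] by metis
  have M: "naf_weight ?x' \<le> weight (drop (Suc (Suc m)) M)"
    by (rule naf_weight_le_weight[OF ternary_drop[OF M.ternary]])
  have "?x = ?x' \<or> \<bar>?x - ?x'\<bar> = 1 \<and> M ! m \<noteq> 0 \<and> M ! Suc m \<noteq> 0"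
    using gap_cases[OF R.ternary M.ternary] length vals assms by simp
  then show ?thesis
  proof (elim disjE conjE)
    assume "\<bar>?x - ?x'\<bar> = 1"
    then have "?x = ?x' + 1 \<or> ?x' = ?x + 1" by linarith
    then have "naf_weight ?x \<le> naf_weight ?x' + 1"
      using naf_weight_lipschitz[of ?x] naf_weight_lipschitz[of ?x'] by auto
    moreover assume "M ! m \<noteq> 0" "M ! Suc m \<noteq> 0"
    then have "\<bar>M ! m\<bar> \<ge> 1" "\<bar>M ! Suc m\<bar> \<ge> 1" by linarith+
    ultimately show ?thesis
      using R M weight_drop_Suc[of m M] weight_drop_Suc[of "Suc m" M] length assms by simp
  qed (use R M in simp)
qed

lemma T_le:
  fixes D A :: real
  assumes D: "D > 0" and A: "A \<ge> 2 * D"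
  shows "T D A R L \<le> T D A M L"
proof (rule R.T_upper)
  have vL: "v \<le> L" using R.first length by simp
  have A0: "A \<ge> 0" using D A by simp
  show "v \<le> L" "L < length R" "0 \<le> D" using vL length D by simp_all
  show "real v * D \<le> T D A M L"
    using M.T_ge_first[of D A L] D A0 vL length by simp
  have T_ge: "real j * D + A * w \<le> T D A M L" if "v < j" "0 < w" "w \<le> weight (drop j M)" for j and w :: int
  proof -
    have "real j * D + A * weight (drop j M) \<le> T D A M L"
      using M.T_lower[of D A L j] that D A0 vL length by simp
    moreover have "A * w \<le> A * weight (drop j M)"
      using that A0 by (intro mult_left_mono) auto
    ultimately show ?thesis by simp
  qed
  fix i assume "v < i" "i \<le> L" "R ! i \<noteq> 0"
  then have "real i * D + A * weight (drop i R) \<le> T D A M L"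
  proof (induction i rule: less_induct)
    case (less i)
    have iR: "i < length R" using less.prems length by simp
    have pos: "weight (drop i R) > 0"
      using weight_drop_Suc[OF iR] less.prems(3) weight_nonneg[of "drop (Suc i) R"] by simp
    \<comment> \<open>Descending at most two positions loses at most \<open>2 * D\<close>, hence at
      most \<open>A\<close>, which one additional nonzero digit recovers.\<close>
    have shift: ?case
      if "v < j" "i \<le> j + 2" "real j * D + A * (weight (drop i R) + 1) \<le> T D A M L" for j
    proof -
      have "real i * D \<le> real (j + 2) * D"
        using that(2) D by (intro mult_right_mono) auto
      then have "real i * D \<le> real j * D + A" using A by (simp add: algebra_simps)
      then show ?thesis using that(3) by (simp add: algebra_simps)
    qed
    show ?case
    \<comment> \<open>The position \<open>v\<close> is excluded, since the first nonzero digit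
      contributes no \<open>A\<close> to \<open>T\<close>.\<close>
    proof (cases "\<exists>j<i. v < j \<and> i \<le> j + 2 \<and> R ! j \<noteq> 0")
      case True
      then obtain j where j: "j < i" "v < j" "i \<le> j + 2" "R ! j \<noteq> 0" by blast
      have "weight (drop i R) \<le> weight (drop (Suc j) R)"
        using j by (intro weight_drop_mono) simp
      then have "weight (drop i R) + 1 \<le> weight (drop j R)"
        using weight_drop_Suc[of j R] j iR by simp
      then have "A * (weight (drop i R) + 1) \<le> A * weight (drop j R)"
        using A0 by (intro mult_left_mono) linarith+
      moreover have "real j * D + A * weight (drop j R) \<le> T D A M L"
        using less.IH[of j] j less.prems by simp
      ultimately show ?thesis using shift[of j] j by simp
    next
      case False
      have "i = Suc v \<or> i = Suc (Suc v) \<or> i = Suc (Suc (i - 2)) \<and> v < i - 2"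
        using less.prems(1) by linarith
      then consider "i = Suc v" | "i = Suc (Suc v)" | m where "i = Suc (Suc m)" "v < m" by blast
      then show ?thesis
      proof cases
        case 1
        then show ?thesis using T_ge[of i "weight (drop i R)"] pos weight_tail_le by simp
      next
        case 2
        have "\<not> (Suc v < i \<and> v < Suc v \<and> i \<le> Suc v + 2 \<and> R ! Suc v \<noteq> 0)" using False by blast
        then have R0: "R ! Suc v = 0" using 2 by simp
        have vR: "Suc v < length R" using iR 2 by simp
        have R: "weight (drop (Suc v) R) = weight (drop i R)"
          using weight_drop_Suc[OF vR] R0 2 by simp
        have vM: "Suc v < length M" using 2 less.prems length by simp
        show ?thesis
        proof (cases "M ! Suc v = 0")
          case True
          then show ?thesis
            using T_ge[of i "weight (drop i R)"] pos weight_tail_le R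
              weight_drop_Suc[OF vM] 2 by simp
        next
          \<comment> \<open>The digit of \<open>M\<close> at \<open>v + 1\<close> makes its tail
            odd, hence strictly heavier than that of \<open>R\<close>.\<close>
          case M: False
          then have "real (Suc v) * D + A * (weight (drop i R) + 1 :: int) \<le> T D A M L"
            using T_ge[of "Suc v" "weight (drop i R) + 1"] pos weight_tail_less[OF vM R0] R by simp
          then show ?thesis using shift[of "Suc v"] 2 by simp
        qed
      next
        case (3 m)
        have "\<not> (m < i \<and> v < m \<and> i \<le> m + 2 \<and> R ! m \<noteq> 0)"
          "\<not> (Suc m < i \<and> v < Suc m \<and> i \<le> Suc m + 2 \<and> R ! Suc m \<noteq> 0)"
          using False by blast+
        then have "R ! m = 0" "R ! Suc m = 0" using 3 by simp_all
        then have "weight (drop i R) \<le> weight (drop i M) \<or> weight (drop i R) < weight (drop m M)"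
          using weight_gap[of m] 3 less.prems by simp
        then show ?thesis
        proof
          assume "weight (drop i R) \<le> weight (drop i M)"
          then show ?thesis using T_ge[of i "weight (drop i R)"] pos less.prems by simp
        next
          assume "weight (drop i R) < weight (drop m M)"
          then have "real m * D + A * (weight (drop i R) + 1 :: int) \<le> T D A M L"
            using T_ge[of m "weight (drop i R) + 1"] pos 3 by simp
          then show ?thesis using shift[of m] 3 by simp
        qed
      qed
    qed
  qed
  then show "real i * D + A * weight (drop i (take (Suc L) R)) \<le> T D A M L"
    using length by simp
qed

end

section \<open>The patterns\<close>

lemma weight_step_even: "naf_weight (2 * u) \<le> naf_weight (2 * u + 1)"
  using naf_weight_odd[of u] naf_weight_lipschitz[of u] by simp

lemma weight_step_4k3: "naf_weight (4 * s + 4) < naf_weight (4 * s + 3)"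
  using naf_weight_4k3[of s] naf_weight_4k[of "s + 1"] by (simp add: algebra_simps)

text \<open>Removing a low digit pair 01 preserves the comparison; each removal matches one
  repetition of the block \<open>(01)\<close> in the patterns.\<close>

lemma weight_step_4k1:
  "naf_weight (4 * s + 2) < naf_weight (4 * s + 1) \<longleftrightarrow> naf_weight (s + 1) < naf_weight s"
  using naf_weight_4k1[of s] naf_weight_4k2[of s] naf_weight_odd[of s] by auto

text \<open>Separates the empty repetition of a starred block from the others.\<close>

lemma ex_nat_Suc: "(\<exists>j::nat. P j) \<longleftrightarrow> P 0 \<or> (\<exists>j. P (Suc j))"
  by (metis not0_implies_Suc)

text \<open>From the low end: an even value never gets lighter by adding one, the pair 01 passes the
  question upwards, and 11 always gives a decrease. The list is least significant first, so 01
  appears as \<open>[1, 0]\<close>.\<close>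

lemma weight_step_iff_11:
  assumes "set xs \<subseteq> {0, 1}"
  shows "naf_weight (value_of xs + 1) < naf_weight (value_of xs) \<longleftrightarrow>
    (\<exists>j u. xs = concat (replicate j [1, 0]) @ [1, 1] @ u)"
  using assms
proof (induction xs rule: induct_list012)
  case 1
  then show ?case using naf_weight_4k1[of 0] by simp
next
  case (2 x)
  then show ?case
    using naf_weight_4k1[of 0] weight_step_4k1[of 0] by (subst ex_nat_Suc) auto
next
  case (3 x y zs)
  let ?u = "value_of zs"
  consider "x = 0" | "x = 1" "y = 0" | "x = 1" "y = 1" using 3(3) by auto
  then show ?case
  proof cases
    case 1
    then show ?thesis
      using weight_step_even[of "y + 2 * ?u"] by (subst ex_nat_Suc) auto
  next
    case 2
    then have "(\<exists>j u. x # y # zs = concat (replicate j [1, 0]) @ [1, 1] @ u) \<longleftrightarrow>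
        (\<exists>j u. zs = concat (replicate j [1, 0]) @ [1, 1] @ u)"
      by (subst ex_nat_Suc) auto
    then show ?thesis using 3 2 weight_step_4k1[of ?u] by (simp add: algebra_simps)
  next
    case 3
    then have "\<exists>j u. x # y # zs = concat (replicate j [1, 0]) @ [1, 1] @ u"
      by (subst ex_nat_Suc) auto
    then show ?thesis using 3 weight_step_4k3[of ?u] by (simp add: algebra_simps)
  qed
qed

text \<open>The complementary condition: after the blocks 01 comes 0 instead of 11. The two padding
  zeros let the match finish when the digits run out.\<close>

lemma weight_step_iff_0:
  assumes "set xs \<subseteq> {0, 1}"
  shows "naf_weight (value_of xs) \<le> naf_weight (value_of xs + 1) \<longleftrightarrow>
    (\<exists>j u. xs @ [0, 0] = concat (replicate j [1, 0]) @ [0] @ u)"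
  using assms
proof (induction xs rule: induct_list012)
  case 1
  then show ?case using naf_weight_4k1[of 0] by (subst ex_nat_Suc) simp
next
  case (2 x)
  have "\<exists>j u. [1, 0, 0] = concat (replicate j [1::int, 0]) @ [0] @ u"
    by (rule exI[of _ 1]) simp
  then show ?case
    using 2 naf_weight_4k1[of 0] naf_weight_4k2[of 0]
    by (cases "x = 0") (simp_all, subst ex_nat_Suc, simp)
next
  case (3 x y zs)
  let ?u = "value_of zs"
  consider "x = 0" | "x = 1" "y = 0" | "x = 1" "y = 1" using 3(3) by auto
  then show ?case
  proof cases
    case 1
    then show ?thesis
      using weight_step_even[of "y + 2 * ?u"] by (subst ex_nat_Suc) auto
  next
    case 2
    then have "(\<exists>j u. (x # y # zs) @ [0, 0] = concat (replicate j [1, 0]) @ [0] @ u) \<longleftrightarrow>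
        (\<exists>j u. zs @ [0, 0] = concat (replicate j [1, 0]) @ [0] @ u)"
      by (subst ex_nat_Suc) auto
    then show ?thesis using 3 2 weight_step_4k1[of ?u] by (simp add: algebra_simps not_less[symmetric])
  next
    case 3
    then have "\<not> (\<exists>j u. (x # y # zs) @ [0, 0] = concat (replicate j [1, 0]) @ [0] @ u)"
      by (subst ex_nat_Suc) auto
    then show ?thesis using 3 weight_step_4k3[of ?u] by (simp add: algebra_simps)
  qed
qed

section \<open>Translating the pattern tests into comparisons of weights\<close>

lemma replicate_0_1_eq_iff:
  "replicate v 0 @ (1::int) # A = replicate k 0 @ 1 # B \<longleftrightarrow> v = k \<and> A = B"
proof (induction v arbitrary: k)
  case 0
  then show ?case by (cases k) auto
next
  case (Suc v)
  then show ?case by (cases k) auto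
qed

lemma ends_with_rev: "ends_with (rev S) P \<longleftrightarrow> (\<exists>u. \<exists>p\<in>P. S = rev p @ u)"
  unfolding ends_with_def by (metis rev_append rev_rev_ident)

lemma rev_concat_replicate_01: "rev (concat (replicate j [0, 1])) = concat (replicate j [1, 0 :: int])"
  by (simp add: rev_concat)

lemma pattern1_eq:
  "pattern1 = range (\<lambda>(j, k). [1, 1] @ concat (replicate j [0, 1]) @ [0, 1] @ replicate k 0)"
  by (auto simp: pattern1_def)

lemma pattern2_eq:
  "pattern2 = range (\<lambda>(j, k). [0] @ concat (replicate j [0, 1]) @ [0, 1, 1] @ replicate k 0)"
  by (auto simp: pattern2_def)

text \<open>With \<open>q = value_of ys\<close> the tail above the lowest 1 is \<open>2 * q\<close>.
  The condition on \<open>q\<close> says that the odd tail \<open>2 * q + 1\<close>, left by the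
  digit -1, is no heavier.\<close>

lemma ends_with_pattern1:
  assumes "set xs \<subseteq> {0, 1}"
  shows "ends_with ([0, 0] @ rev (replicate v 0 @ 1 # xs)) pattern1 \<longleftrightarrow>
    (\<exists>ys. xs = 0 # ys \<and> naf_weight (value_of ys + 1) < naf_weight (value_of ys))"
proof -
  have S: "[0, 0] @ rev (replicate v 0 @ 1 # xs) = rev (replicate v 0 @ 1 # xs @ [0, 0])" by simp
  have "ends_with ([0, 0] @ rev (replicate v 0 @ 1 # xs)) pattern1 \<longleftrightarrow>
      (\<exists>u j k. replicate v 0 @ 1 # xs @ [0, 0] =
        replicate k 0 @ 1 # 0 # concat (replicate j [1, 0]) @ [1, 1] @ u)"
    unfolding S ends_with_rev pattern1_eq
    by (simp add: rev_concat_replicate_01 split_paired_Ex)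
  also have "\<dots> \<longleftrightarrow> (\<exists>u j. xs @ [0, 0] = 0 # concat (replicate j [1, 0]) @ [1, 1] @ u)"
    unfolding replicate_0_1_eq_iff by auto
  also have "\<dots> \<longleftrightarrow> (\<exists>ys. xs = 0 # ys \<and> naf_weight (value_of ys + 1) < naf_weight (value_of ys))"
  proof (cases xs)
    case Nil
    have "\<not> (\<exists>j u. [0] = concat (replicate j [1, 0]) @ [1, 1 :: int] @ u)"
      by (subst ex_nat_Suc) auto
    then show ?thesis using Nil by auto
  next
    case (Cons b ys)
    then show ?thesis
      using weight_step_iff_11[of "ys @ [0, 0]"] assms by (auto simp: value_of_append)
  qed
  finally show ?thesis .
qed

text \<open>Here the tail is \<open>2 * q + 1\<close> with \<open>q = value_of ys\<close>, and the
  condition says that it is no heavier than the even tail \<open>2 * q + 2\<close>.\<close>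

lemma ends_with_pattern2:
  assumes "set xs \<subseteq> {0, 1}"
  shows "ends_with ([0, 0] @ rev (replicate v 0 @ 1 # xs)) pattern2 \<longleftrightarrow>
    (\<exists>ys. xs = 1 # ys \<and> naf_weight (value_of ys) < naf_weight (value_of ys + 1))"
proof -
  have S: "[0, 0] @ rev (replicate v 0 @ 1 # xs) = rev (replicate v 0 @ 1 # xs @ [0, 0])" by simp
  have "ends_with ([0, 0] @ rev (replicate v 0 @ 1 # xs)) pattern2 \<longleftrightarrow>
      (\<exists>u j k. replicate v 0 @ 1 # xs @ [0, 0] =
        replicate k 0 @ 1 # 1 # 0 # concat (replicate j [1, 0]) @ [0] @ u)"
    unfolding S ends_with_rev pattern2_eq
    by (simp add: rev_concat_replicate_01 split_paired_Ex)
  also have "\<dots> \<longleftrightarrow> (\<exists>u j. xs @ [0, 0] = 1 # 0 # concat (replicate j [1, 0]) @ [0] @ u)"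
    unfolding replicate_0_1_eq_iff by auto
  also have "\<dots> \<longleftrightarrow> (\<exists>ys. xs = 1 # ys \<and> naf_weight (value_of ys) < naf_weight (value_of ys + 1))"
  proof (cases xs)
    case (Cons b ys)
    show ?thesis
    proof (cases ys)
      case Nil
      have "\<exists>j u. [0] = concat (replicate j [1, 0]) @ [0 :: int] @ u"
        by (rule exI[of _ 0]) simp
      then show ?thesis using Cons Nil naf_weight_4k1[of 0] by auto
    next
      case (Cons c zs)
      let ?u = "value_of zs"
      \<comment> \<open>This settles \<open>c = 0\<close>, the digit that the pattern demands; the
        next inequality refutes the weight condition for \<open>c = 1\<close>.\<close>
      have "naf_weight (2 * ?u) < naf_weight (2 * ?u + 1) \<longleftrightarrow> naf_weight ?u \<le> naf_weight (?u + 1)"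
        using naf_weight_odd[of ?u] by auto
      moreover have "naf_weight (2 * ?u + 2) \<le> naf_weight (2 * ?u + 1)"
        using naf_weight_odd[of ?u] naf_weight_lipschitz[of ?u] naf_weight_double[of "?u + 1"]
        by (simp add: algebra_simps)
      moreover have xs_eq: "xs = b # c # zs" using Cons \<open>xs = b # ys\<close> by simp
      moreover have "b \<in> {0, 1}" "c \<in> {0, 1}" "set zs \<subseteq> {0, 1}" using assms xs_eq by auto
      moreover have "(\<exists>u j. zs @ [0, 0] = concat (replicate j [1, 0]) @ [0] @ u) \<longleftrightarrow>
          naf_weight ?u \<le> naf_weight (?u + 1)"
        using weight_step_iff_0[OF \<open>set zs \<subseteq> {0, 1}\<close>] by (subst ex_comm) (rule sym)
      ultimately show ?thesis
        by (elim insertE emptyE) (simp_all add: add.commute)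
    qed
  qed simp
  finally show ?thesis .
qed

section \<open>Algorithm 2\<close>

text \<open>Covers all three calls in Algorithm 2: from \<open>v + 1\<close>, where the digit
  \<open>d\<close> at \<open>v\<close> is kept, and from \<open>v\<close>.\<close>

lemma toNAF_digit_string:
  assumes N: "N = replicate v 0 @ d # zs" and zs: "set zs \<subseteq> {0, 1}"
    and i0: "i0 = Suc v \<and> zs \<noteq> [] \<and> d \<in> {-1, 1} \<or> i0 = v \<and> d = 1"
  shows "digit_string (toNAF N i0) v" "length (toNAF N i0) = Suc (length N)"
    "value_of (toNAF N i0) = value_of N" "non_adjacent (drop i0 (toNAF N i0))"
    "i0 = Suc v \<Longrightarrow> toNAF N i0 ! v = d"
proof -
  have i0_less: "i0 < length N" using N i0 by auto
  have bin: "N ! j \<in> {0, 1}" if "i0 \<le> j" "j < length N" for j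
  proof -
    have "N ! j = (d # zs) ! (j - v)" "j - v < Suc (length zs)"
      using that i0 by (auto simp: N nth_append)
    moreover have "zs ! k \<in> {0, 1}" if "k < length zs" for k
      using zs that nth_mem by blast
    ultimately show ?thesis using that(1) i0 by (cases "j - v") auto
  qed
  note spec = toNAF_spec[OF i0_less bin]
  show "length (toNAF N i0) = Suc (length N)" "value_of (toNAF N i0) = value_of N"
    "non_adjacent (drop i0 (toNAF N i0))"
    using spec by blast+
  show "toNAF N i0 ! v = d" if "i0 = Suc v"
    using spec(2)[of v] that N by (simp add: nth_append)
  have "take i0 (toNAF N i0) = take i0 N"
    using spec(1,2) i0_less by (intro nth_equalityI) auto
  moreover have "ternary N" using N zs i0 by auto
  ultimately have "ternary (take i0 (toNAF N i0) @ drop i0 (toNAF N i0))"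
    using ternary_take[of N i0] spec(4) by (simp del: append_take_drop_id)
  then have "ternary (toNAF N i0)" by simp
  moreover have "value_of (toNAF N i0) = 2 ^ v * (d + 2 * value_of zs)"
    using spec(3) N by (simp add: value_of_append)
  moreover have "d + 2 * value_of zs = 1 + 2 * (value_of zs + (d - 1) div 2)"
    using i0 by auto
  ultimately show "digit_string (toNAF N i0) v"
    using digit_stringI[of "toNAF N i0" v "value_of zs + (d - 1) div 2"] spec(1) N by simp
qed

text \<open>The correction \<open>(1 - M ! v) div 2\<close> is 0 for the digit 1 and 1 for the digit
  -1.\<close>

lemma (in digit_string) weight_tail_NAF:
  assumes val: "value_of M = 2 ^ v * (1 + 2 * y)"
    and NAF: "non_adjacent (drop (Suc v) M)"
  shows "weight (drop (Suc v) M) = naf_weight (y + (1 - M ! v) div 2)"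
    and "Suc v < length M \<Longrightarrow> M ! Suc v = 0 \<Longrightarrow> even (y + (1 - M ! v) div 2)"
proof -
  have "M ! v + 2 * value_of (drop (Suc v) M) = 1 + 2 * y"
    using value_of_first val by simp
  then have val': "value_of (drop (Suc v) M) = y + (1 - M ! v) div 2"
    using digit[OF first(1)] first(2) by auto
  then show "weight (drop (Suc v) M) = naf_weight (y + (1 - M ! v) div 2)"
    using weight_non_adjacent[OF ternary_drop[OF ternary] NAF] by simp
  assume "Suc v < length M" "M ! Suc v = 0"
  then have "value_of (drop (Suc v) M) = 2 * value_of (drop (Suc (Suc v)) M)"
    by (metis Cons_nth_drop_Suc value_of_Cons add_0)
  then show "even (y + (1 - M ! v) div 2)" using val' by simp
qed

text \<open>Supplies what \<open>same_value\<close> demands of the output. The cases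
  \<open>dec\<close> and \<open>inc\<close> are named after the change of weight from
  \<open>value_of ys\<close> to its successor.\<close>

lemma algorithm2_properties:
  assumes N: "N = replicate v 0 @ 1 # xs" and xs: "set xs \<subseteq> {0, 1}"
  defines "R \<equiv> algorithm2 N" and "y \<equiv> value_of xs"
  shows "digit_string R v" "length R = Suc (length N)" "value_of R = value_of N"
    "non_adjacent (drop (Suc v) R)"
    "weight (drop (Suc v) R) \<le> min (naf_weight y) (naf_weight (y + 1))"
    "R ! Suc v = 0 \<Longrightarrow> weight (drop (Suc v) R) < naf_weight (2 * (y div 2) + 1)"
proof -
  have l: "(LEAST i. i < length N \<and> N ! i = 1) = v"
    by (rule Least_equality) (auto simp: N nth_append split: if_splits)
  have val_N: "value_of N = 2 ^ v * (1 + 2 * y)" by (simp add: N y_def value_of_append)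
  define dec inc where "dec = (\<exists>ys. xs = 0 # ys \<and> naf_weight (value_of ys + 1) < naf_weight (value_of ys))"
    and "inc = (\<exists>ys. xs = 1 # ys \<and> naf_weight (value_of ys) < naf_weight (value_of ys + 1))"
  have patterns: "ends_with ([0, 0] @ rev N) pattern1 \<longleftrightarrow> dec"
    "ends_with ([0, 0] @ rev N) pattern2 \<longleftrightarrow> inc"
    unfolding N dec_def inc_def using ends_with_pattern1[OF xs] ends_with_pattern2[OF xs] by blast+
  have R: "R = (if dec then toNAF (N[v := -1, v + 1 := 1]) (v + 1)
      else if inc then toNAF N (v + 1) else toNAF N v)"
    unfolding R_def algorithm2_def Let_def l patterns by (rule refl)
  have "digit_string R v \<and> length R = Suc (length N) \<and> value_of R = value_of N \<and>
    non_adjacent (drop (Suc v) R) \<and>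
    weight (drop (Suc v) R) \<le> min (naf_weight y) (naf_weight (y + 1)) \<and>
    (R ! Suc v = 0 \<longrightarrow> weight (drop (Suc v) R) < naf_weight (2 * (y div 2) + 1))"
  proof -
    consider (dec) ys where "dec" "xs = 0 # ys" "naf_weight (value_of ys + 1) < naf_weight (value_of ys)"
      | (inc) ys where "\<not> dec" "inc" "xs = 1 # ys" "naf_weight (value_of ys) < naf_weight (value_of ys + 1)"
      | (none) "\<not> dec" "\<not> inc"
      unfolding dec_def inc_def by blast
    then show ?thesis
    proof cases
      case (dec ys)
      define N' where "N' = N[v := -1, v + 1 := 1]"
      have N': "N' = replicate v 0 @ -1 # 1 # ys"
        unfolding N'_def N dec(2) by (simp add: list_update_append)
      have ys: "set (1 # ys) \<subseteq> {0, 1}" using xs dec by auto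
      have R': "R = toNAF N' (Suc v)" using R dec N'_def by simp
      have val: "value_of N' = value_of N" by (simp add: N' N dec(2) value_of_append)
      note spec = toNAF_digit_string[OF N' ys, of "Suc v", simplified, folded R']
      interpret digit_string R v by (rule spec)
      have y: "y = 2 * value_of ys" using dec by (simp add: y_def)
      have Rv: "R ! v = -1" using spec by simp
      have vals: "value_of R = 2 ^ v * (1 + 2 * y)" using spec(3) val val_N by simp
      have len: "length R = Suc (length N)" using spec(2) N' N dec by simp
      then have "Suc v < length R" using N by simp
      \<comment> \<open>The tail \<open>y + 1\<close> is odd, so its lowest digit is nonzero and the
        last claim is vacuous; its weight is \<open>1 + naf_weight (value_of ys + 1)\<close>, at
        most \<open>naf_weight y\<close>.\<close>
      then show ?thesis
        using weight_tail_NAF[OF vals spec(4)] spec vals val_N len Rv y dec(3)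
          naf_weight_odd[of "value_of ys"] naf_weight_lipschitz[of "value_of ys"] by auto
    next
      case (inc ys)
      have R': "R = toNAF N (Suc v)" using R inc by simp
      have ne: "xs \<noteq> []" using inc by simp
      note spec = toNAF_digit_string[OF N xs, of "Suc v", simplified, folded R', OF ne]
      interpret digit_string R v by (rule spec)
      have y: "y = 2 * value_of ys + 1" using inc by (simp add: y_def)
      have y1: "naf_weight (y + 1) = naf_weight (value_of ys + 1)"
        using naf_weight_double[of "value_of ys + 1"] by (simp add: y algebra_simps)
      have Rv: "R ! v = 1" using spec by simp
      have vals: "value_of R = 2 ^ v * (1 + 2 * y)" using spec(3) val_N by simp
      have "Suc v < length R" using spec(2) N by simp
      \<comment> \<open>Again the tail, now \<open>y\<close> itself, is odd; its weight
        \<open>1 + naf_weight (value_of ys)\<close> is at most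
        \<open>naf_weight (y + 1)\<close>.\<close>
      then show ?thesis
        using weight_tail_NAF[OF vals spec(4)] spec vals Rv y y1 inc(4)
          naf_weight_odd[of "value_of ys"] by auto
    next
      case none
      have R': "R = toNAF N v" using R none by simp
      note spec = toNAF_digit_string[OF N xs, of v, simplified, folded R']
      interpret digit_string R v by (rule spec)
      have vals: "value_of R = 2 ^ v * (1 + 2 * y)" using spec(3) val_N by simp
      have NAF: "non_adjacent (drop (Suc v) R)"
        using non_adjacent_drop[OF spec(4), of 1] by simp
      have "value_of (drop v R) = 1 + 2 * y"
        using value_of_first vals Cons_nth_drop_Suc[OF first(1)] value_of_Cons
        by (metis mult_cancel_left power_not_zero zero_neq_numeral)
      then have "weight (drop v R) = 1 + min (naf_weight y) (naf_weight (y + 1))"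
        using weight_non_adjacent[OF ternary_drop[OF ternary] spec(4)] naf_weight_odd[of y]
        by (simp add: add.commute)
      moreover have "\<bar>R ! v\<bar> = 1" using digit[OF first(1)] first(2) by auto
      ultimately have W: "weight (drop (Suc v) R) = min (naf_weight y) (naf_weight (y + 1))"
        using weight_drop_Suc[OF first(1)] by simp
      \<comment> \<open>Failure of both patterns means that the even one of \<open>y\<close> and
        \<open>y + 1\<close> is strictly lighter than the odd one.\<close>
      have "min (naf_weight y) (naf_weight (y + 1)) < naf_weight (2 * (y div 2) + 1)"
      proof (cases xs)
        case Nil
        then show ?thesis using naf_weight_4k1[of 0] by (simp add: y_def)
      next
        case (Cons b ys)
        let ?q = "value_of ys"
        have "naf_weight (2 * (?q + 1)) = naf_weight (?q + 1)" by (rule naf_weight_double)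
        moreover have "naf_weight (?q * 2) = naf_weight ?q" by (metis mult.commute naf_weight_double)
        ultimately show ?thesis
          using none xs Cons naf_weight_odd[of ?q]
          by (auto simp: dec_def inc_def y_def algebra_simps)
      qed
      then show ?thesis using spec W NAF by simp
    qed
  qed
  then show "digit_string R v" "length R = Suc (length N)" "value_of R = value_of N"
    "non_adjacent (drop (Suc v) R)"
    "weight (drop (Suc v) R) \<le> min (naf_weight y) (naf_weight (y + 1))"
    "R ! Suc v = 0 \<Longrightarrow> weight (drop (Suc v) R) < naf_weight (2 * (y div 2) + 1)"
    by blast+
qed

theorem theorem4:
  fixes D A :: real and n lam :: nat and N :: "int list"
  assumes "D > 0" and "A \<ge> 2 * D"
    and "n > 0"
    and "binary_expansion n lam N"
  shows "canonical_rep n (lam + 1) (algorithm2 N) \<and>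
    (\<forall>M. canonical_rep n (lam + 1) M \<longrightarrow>
       T D A (algorithm2 N) (lam + 1) \<le> T D A M (lam + 1))"
proof -
  have N: "length N = Suc lam" "set N \<subseteq> {0, 1}" "N ! lam = 1" "value_of N = int n"
    using assms(4) by (auto simp: binary_expansion_def)
  have "1 \<in> set N" using N(1,3) by (metis lessI nth_mem)
  then obtain ys xs where split: "N = ys @ 1 # xs" "1 \<notin> set ys"
    by (metis split_list_first)
  have "replicate (length ys) 0 = ys"
    using split N(2) by (intro replicate_eqI[symmetric]) auto
  then obtain v where split: "N = replicate v 0 @ 1 # xs" using split by metis
  have xs: "set xs \<subseteq> {0, 1}" using N(2) split by auto
  define y where "y = value_of xs"
  define R where "R = algorithm2 N"
  note R = algorithm2_properties[OF split xs, folded R_def y_def]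
  have val: "int n = 2 ^ v * (1 + 2 * y)"
    using N(4) split by (simp add: value_of_append y_def)
  have "canonical_rep n (lam + 1) R"
    using R N digit_string.ternary[OF R(1)] by (simp add: canonical_rep_def)
  moreover have "T D A R (lam + 1) \<le> T D A M (lam + 1)" if "canonical_rep n (lam + 1) M" for M
  proof -
    have M: "length M = Suc (lam + 1)" "ternary M" "value_of M = 2 ^ v * (1 + 2 * y)"
      using that val by (auto simp: canonical_rep_def)
    have "v < length M" using M(1) N(1) split by simp
    interpret R: digit_string R v by (rule R)
    \<comment> \<open>The odd cofactor of \<open>n\<close> forces every competitor to have its
      lowest nonzero digit at the same \<open>v\<close>.\<close>
    interpret M: digit_string M v using digit_stringI M \<open>v < length M\<close> by blast
    interpret same_value R M v "lam + 1" y
      using R M N val by unfold_locales simp_all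
    show ?thesis using T_le assms(1,2) by blast
  qed
  ultimately show ?thesis unfolding R_def by blast
qed

end
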